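(* In the RESTART model with task time distribution $F$, failure time distribution $G$ and total time $X$, assume that the support of $F$ is unbounded. Then for any $\epsilon>0$, $$e^{\epsilon x}\,\overline H(x)\ \to\ \infty\qquad\text{as } x\to\infty .$$
   Context: RESTART model: $T$ is a nonnegative random variable (task time) with distribution $F$ having density $f$ on $[0,\infty)$. $U, U_1,U_2,\ldots$ are nonnegative i.i.d. random variables (failure times) with distribution $G$ having density $g$, independent of $T$. $N=\inf\{n\ge 0:\,U_{n+1}>T\}$, $S=\sum_{i=1}^N U_i$, and the total time is $X=T+S$ (with $X=\infty$ if $N=\infty$). Write $\overline H(x)=\mathbb P(X>x)$. Standing assumption: $\mu=1/\mathbb E U>0$, i.e. $\mathbb E U<\infty$. *)

theory Defs
  imports "HOL-Probability.Probability" "HOL-Library.Extended_Nat"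
begin

definition measure_support :: "'b::topological_space measure \<Rightarrow> 'b set" where
  "measure_support \<nu> = {x. \<forall>A. open A \<longrightarrow> x \<in> A \<longrightarrow> 0 < emeasure \<nu> A}"

text \<open>
  The failure times \<open>U\<^sub>1, U\<^sub>2, \<dots>\<close> are indexed from 0, i.e. \<open>U n\<close> stands for
  \<open>U\<^sub>n\<^sub>+\<^sub>1\<close>. Only the restrictions of the densities \<open>f\<close> and \<open>g\<close> to \<open>[0, \<infinity>)\<close> matter.
  The assumption \<open>indep\<close> says that the family \<open>T, U 0, U 1, \<dots>\<close> is mutually independent, which
  is to say that the \<open>U n\<close> are independent and their sequence is independent of \<open>T\<close>
  (the library's \<open>indep_var\<close> is not applicable to the pair of \<open>T\<close> and the sequence because it
  needs variables of a common type).
\<close>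

locale restart_model = prob_space M
  for M :: "'a measure" and T :: "'a \<Rightarrow> real" and U :: "nat \<Rightarrow> 'a \<Rightarrow> real"
    and f g :: "real \<Rightarrow> real" +
  assumes T_nonneg: "\<And>\<omega>. \<omega> \<in> space M \<Longrightarrow> 0 \<le> T \<omega>"
    and U_nonneg: "\<And>n \<omega>. \<omega> \<in> space M \<Longrightarrow> 0 \<le> U n \<omega>"
    and f_nonneg: "\<And>x. 0 \<le> x \<Longrightarrow> 0 \<le> f x"
    and g_nonneg: "\<And>x. 0 \<le> x \<Longrightarrow> 0 \<le> g x"
    and T_density: "distributed M lborel T (\<lambda>x. ennreal (f x) * indicator {0..} x)"
    and U_density: "\<And>n. distributed M lborel (U n) (\<lambda>x. ennreal (g x) * indicator {0..} x)"
    and indep: "indep_vars (\<lambda>_. borel) (case_nat T U) UNIV"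
    and U_finite_mean: "integrable M (U 0)"

text \<open>The infimum of the empty set in \<^typ>\<open>enat\<close> is \<open>\<infinity>\<close>.\<close>

definition restart_N :: "('a \<Rightarrow> real) \<Rightarrow> (nat \<Rightarrow> 'a \<Rightarrow> real) \<Rightarrow> 'a \<Rightarrow> enat" where
  "restart_N T U \<omega> = Inf {enat n |n. U n \<omega> > T \<omega>}"

definition restart_S :: "('a \<Rightarrow> real) \<Rightarrow> (nat \<Rightarrow> 'a \<Rightarrow> real) \<Rightarrow> 'a \<Rightarrow> ereal" where
  "restart_S T U \<omega> =
     (case restart_N T U \<omega> of
        enat n \<Rightarrow> (\<Sum>i<n. ereal (U i \<omega>))
      | \<infinity> \<Rightarrow> (\<Sum>i. ereal (U i \<omega>)))"

definition restart_X :: "('a \<Rightarrow> real) \<Rightarrow> (nat \<Rightarrow> 'a \<Rightarrow> real) \<Rightarrow> 'a \<Rightarrow> ereal" where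
  "restart_X T U \<omega> =
     (if restart_N T U \<omega> = \<infinity> then \<infinity> else ereal (T \<omega>) + restart_S T U \<omega>)"

definition restart_tail ::
    "'a measure \<Rightarrow> ('a \<Rightarrow> real) \<Rightarrow> (nat \<Rightarrow> 'a \<Rightarrow> real) \<Rightarrow> real \<Rightarrow> real" where
  "restart_tail M T U x = measure M {\<omega> \<in> space M. restart_X T U \<omega> > ereal x}"

end

theory Submission imports Defs begin

text \<open>
  It suffices to bound \<open>P(X > x)\<close> from below by a constant times \<open>exp (- \<epsilon> x / 2)\<close>. Fix a level
  \<open>t\<close>. On the event \<open>T > t\<close>, failure times that are at most \<open>t\<close> never let the task finish, so \<open>X\<close>
  exceeds their sum as long as no failure time above \<open>t\<close> has occurred. The sum is made large by
  grouping the failure times into blocks of length \<open>k\<close>: call a block good if all its entries are at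
  most \<open>t\<close> and at least one of them exceeds a fixed \<open>a > 0\<close>. Each good block adds more than \<open>a\<close> to
  the sum, so \<open>m \<ge> x / a\<close> good initial blocks together with \<open>T > t\<close> force \<open>X > x\<close>
  (\<open>restart_X_gt_of_good_blocks\<close>).

  By independence this event has probability \<open>P(T > t) * \<beta> ^ m\<close>, where
  \<open>\<beta> = P(U \<le> t) ^ k - P(U \<le> a) ^ k\<close> (\<open>prob_good_blocks\<close>). As \<open>U\<close> has a density, it is not
  almost surely \<open>0\<close>, so \<open>a\<close> can be chosen with \<open>P(U \<le> a) < 1\<close>. With this \<open>a\<close> fixed, \<open>\<beta>\<close> comes as
  close to \<open>1\<close> as desired by taking first \<open>k\<close> and then \<open>t\<close> large
  (\<open>ex_good_block_prob_gt\<close>). In particular \<open>\<beta> > exp (- \<epsilon> a / 2)\<close> is possible, which turns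
  \<open>\<beta> ^ m\<close> with \<open>m \<approx> x / a\<close> into the required bound. The unbounded support of \<open>F\<close> makes the factor
  \<open>P(T > t)\<close> positive, however large \<open>t\<close> had to be.
\<close>

section \<open>Lower bounds for the total time\<close>

text \<open>
  Both cases of the definition of \<open>X\<close> are covered: the universal statement is vacuous if no failure
  time exceeds the task time, and otherwise speaks of the single index \<open>n = N\<close>. The right-hand side
  is built from countably many measurable conditions on real random variables.
\<close>

lemma restart_X_gt_iff:
  "ereal x < restart_X T U \<omega> \<longleftrightarrow>
     (\<forall>n. T \<omega> < U n \<omega> \<and> (\<forall>i<n. U i \<omega> \<le> T \<omega>) \<longrightarrow> x < T \<omega> + (\<Sum>i<n. U i \<omega>))"
proof (cases "\<exists>n. T \<omega> < U n \<omega>")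
  case False
  then have "{enat n |n. U n \<omega> > T \<omega>} = {}" by auto
  then have "restart_N T U \<omega> = \<infinity>"
    by (simp add: restart_N_def Inf_enat_def)
  then show ?thesis using False by (auto simp: restart_X_def)
next
  case True
  define n where "n = (LEAST n. T \<omega> < U n \<omega>)"
  have n: "T \<omega> < U n \<omega>" unfolding n_def by (rule LeastI_ex[OF True])
  have least: "n \<le> k" if "T \<omega> < U k \<omega>" for k
    unfolding n_def by (rule Least_le[where P="\<lambda>n. T \<omega> < U n \<omega>", OF that])
  have N: "restart_N T U \<omega> = enat n"
    unfolding restart_N_def
  proof (rule antisym)
    show "Inf {enat n |n. U n \<omega> > T \<omega>} \<le> enat n" using n by (intro Inf_lower) auto
    show "enat n \<le> Inf {enat n |n. U n \<omega> > T \<omega>}" using least by (intro Inf_greatest) auto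
  qed
  have first: "T \<omega> < U k \<omega> \<and> (\<forall>i<k. U i \<omega> \<le> T \<omega>) \<longleftrightarrow> k = n" for k
  proof
    assume k: "T \<omega> < U k \<omega> \<and> (\<forall>i<k. U i \<omega> \<le> T \<omega>)"
    then have "n \<le> k" using least by blast
    moreover have "\<not> n < k" using k n by (meson not_le)
    ultimately show "k = n" by simp
  next
    assume "k = n"
    then show "T \<omega> < U k \<omega> \<and> (\<forall>i<k. U i \<omega> \<le> T \<omega>)" using n least by (meson not_le)
  qed
  have "restart_X T U \<omega> = ereal (T \<omega> + (\<Sum>i<n. U i \<omega>))"
    by (simp add: restart_X_def N restart_S_def)
  then show ?thesis by (simp add: first)
qed

definition good_block :: "nat \<Rightarrow> real \<Rightarrow> real \<Rightarrow> (nat \<Rightarrow> real) \<Rightarrow> nat \<Rightarrow> bool" where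
  "good_block k a t u b \<longleftrightarrow> (\<forall>i\<in>{b*k..<b*k+k}. u i \<le> t) \<and> (\<exists>i\<in>{b*k..<b*k+k}. a < u i)"

lemma good_blocks_sum_ge:
  assumes "\<And>i. 0 \<le> u i" and "\<And>b. b < m \<Longrightarrow> good_block k a t u b"
  shows "real m * a \<le> (\<Sum>i<m*k. u i)"
proof -
  have "real m * a = (\<Sum>b<m. a)" by simp
  also have "\<dots> \<le> (\<Sum>b<m. sum u {b*k..<b*k+k})"
  proof (rule sum_mono)
    fix b assume "b \<in> {..<m}"
    then obtain i where i: "i \<in> {b*k..<b*k+k}" "a < u i"
      using assms(2)[of b] by (auto simp: good_block_def)
    have "u i \<le> sum u {b*k..<b*k+k}" by (rule member_le_sum) (use i assms(1) in auto)
    then show "a \<le> sum u {b*k..<b*k+k}" using i by simp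
  qed
  also have "\<dots> = (\<Sum>i<m*k. u i)" by (rule sum.nat_group)
  finally show ?thesis .
qed

text \<open>
  No failure time in a good block exceeds \<open>t < T\<close>, so the task does not finish during the good
  blocks and the failure times in them are all part of \<open>S\<close>.
\<close>

lemma restart_X_gt_of_good_blocks:
  assumes U: "\<And>i. 0 \<le> U i \<omega>" and "0 \<le> t" and T: "t < T \<omega>"
    and good: "\<And>b. b < m \<Longrightarrow> good_block k a t (\<lambda>i. U i \<omega>) b"
    and x: "x \<le> real m * a"
  shows "ereal x < restart_X T U \<omega>"
  unfolding restart_X_gt_iff
proof (intro allI impI, elim conjE)
  fix n assume n: "T \<omega> < U n \<omega>"
  have "m * k \<le> n"
  proof (rule ccontr)
    assume "\<not> m * k \<le> n"
    then have "0 < k" by (cases k) auto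
    with \<open>\<not> m * k \<le> n\<close> have "n div k < m" by (simp add: div_less_iff_less_mult)
    from \<open>0 < k\<close> have "n \<in> {n div k * k..<n div k * k + k}"
      by (metis atLeastLessThan_iff div_times_less_eq_dividend dividend_less_div_times add.commute)
    then have "U n \<omega> \<le> t" using good[OF \<open>n div k < m\<close>] unfolding good_block_def by blast
    then show False using n T by simp
  qed
  have "x \<le> (\<Sum>i<m*k. U i \<omega>)"
    using good_blocks_sum_ge[of "\<lambda>i. U i \<omega>" m k a t] U good x by simp
  also have "\<dots> \<le> (\<Sum>i<n. U i \<omega>)"
    using \<open>m * k \<le> n\<close> U by (intro sum_mono2) auto
  finally show "x < T \<omega> + (\<Sum>i<n. U i \<omega>)" using \<open>0 \<le> t\<close> T by simp
qed

section \<open>Probabilities in the model\<close>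

context restart_model
begin

lemma T_measurable [measurable]: "T \<in> borel_measurable M"
  using distributed_measurable[OF T_density] by simp

lemma U_measurable [measurable]: "U n \<in> borel_measurable M"
  using distributed_measurable[OF U_density] by simp

lemma restart_X_gt_event [measurable]: "{\<omega> \<in> space M. ereal x < restart_X T U \<omega>} \<in> events"
  unfolding restart_X_gt_iff by measurable

lemma prob_U_le_eq: "prob {\<omega> \<in> space M. U n \<omega> \<le> s} = prob {\<omega> \<in> space M. U 0 \<omega> \<le> s}"
proof -
  have "distr M lborel (U n) = distr M lborel (U 0)"
    using distributed_distr_eq_density[OF U_density] by metis
  moreover have "measure (distr M lborel (U j)) {..s} = prob {\<omega> \<in> space M. U j \<omega> \<le> s}" for j
    by (subst measure_distr) (auto intro!: arg_cong[where f=prob])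
  ultimately show ?thesis by metis
qed

lemma prob_block_le:
  assumes "0 < k"
  shows "prob {\<omega> \<in> space M. \<forall>i\<in>{b..<b+k}. U i \<omega> \<le> s} = prob {\<omega> \<in> space M. U 0 \<omega> \<le> s} ^ k"
proof -
  let ?X = "case_nat T U" and ?J = "{Suc b..<Suc b+k}"
  have "prob (\<Inter>j\<in>?J. ?X j -` {..s} \<inter> space M) = (\<Prod>j\<in>?J. prob (?X j -` {..s} \<inter> space M))"
    by (rule indep_varsD[OF indep]) (use assms in auto)
  also have "\<dots> = (\<Prod>j\<in>?J. prob {\<omega> \<in> space M. U 0 \<omega> \<le> s})"
  proof (rule prod.cong)
    fix j assume "j \<in> ?J"
    then obtain i where "j = Suc i" by (cases j) auto
    then have "?X j -` {..s} \<inter> space M = {\<omega> \<in> space M. U i \<omega> \<le> s}" by auto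
    then show "prob (?X j -` {..s} \<inter> space M) = prob {\<omega> \<in> space M. U 0 \<omega> \<le> s}"
      using prob_U_le_eq[of i s] by simp
  qed simp
  also have "\<dots> = prob {\<omega> \<in> space M. U 0 \<omega> \<le> s} ^ k" by simp
  also have "(\<Inter>j\<in>?J. ?X j -` {..s} \<inter> space M) = {\<omega> \<in> space M. \<forall>i\<in>{b..<b+k}. U i \<omega> \<le> s}"
  proof -
    have "?J = Suc ` {b..<b+k}" by simp
    then show ?thesis using assms by (auto simp del: image_Suc_atLeastLessThan)
  qed
  finally show ?thesis .
qed

lemma prob_good_block:
  assumes "0 < k" and "a \<le> t"
  shows "prob {\<omega> \<in> space M. good_block k a t (\<lambda>i. U i \<omega>) b} =
    prob {\<omega> \<in> space M. U 0 \<omega> \<le> t} ^ k - prob {\<omega> \<in> space M. U 0 \<omega> \<le> a} ^ k"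
proof -
  let ?E = "\<lambda>s. {\<omega> \<in> space M. \<forall>i\<in>{b*k..<b*k+k}. U i \<omega> \<le> s}"
  have "{\<omega> \<in> space M. good_block k a t (\<lambda>i. U i \<omega>) b} = ?E t - ?E a"
    by (auto simp: good_block_def not_le)
  moreover have "prob (?E t - ?E a) = prob (?E t) - prob (?E a)"
    using \<open>a \<le> t\<close> by (intro finite_measure_Diff) (auto intro: order_trans)
  ultimately show ?thesis by (simp add: prob_block_le[OF \<open>0 < k\<close>])
qed

text \<open>
  The conditions on \<open>T\<close> and on the single blocks depend on disjoint sets of coordinates of the
  independent family, so their probabilities multiply.
\<close>

lemma prob_good_blocks:
  assumes "0 < k" and "a \<le> t"
  shows "prob {\<omega> \<in> space M. t < T \<omega> \<and> (\<forall>b<m. good_block k a t (\<lambda>i. U i \<omega>) b)} =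
    prob {\<omega> \<in> space M. t < T \<omega>} *
      (prob {\<omega> \<in> space M. U 0 \<omega> \<le> t} ^ k - prob {\<omega> \<in> space M. U 0 \<omega> \<le> a} ^ k) ^ m"
proof -
  \<comment> \<open>Coordinate \<open>0\<close> of the family is \<open>T\<close>, whence the shift of all block indices by one.\<close>
  define K where "K j = (case j of 0 \<Rightarrow> {0} | Suc b \<Rightarrow> Suc ` {b*k..<b*k+k})" for j :: nat
  define A where "A j = (case j of
      0 \<Rightarrow> {y \<in> space (PiM (K 0) (\<lambda>_. borel)). t < y 0}
    | Suc b \<Rightarrow> {y \<in> space (PiM (K (Suc b)) (\<lambda>_. borel)). good_block k a t (\<lambda>i. y (Suc i)) b})"
    for j :: nat
  define Y where "Y j \<omega> = restrict (\<lambda>i. case_nat T U i \<omega>) (K j)" for j \<omega>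
  have disj: "disjoint_family_on K {..m}"
    unfolding disjoint_family_on_def
  proof (intro ballI impI)
    fix i j :: nat assume "i \<noteq> j"
    have less: "{b*k..<b*k+k} \<inter> {c*k..<c*k+k} = {}" if "b < c" for b c
    proof -
      have "b * k + k \<le> c * k" using that
        by (metis Suc_leI add.commute mult_Suc mult_le_mono1)
      then show ?thesis by auto
    qed
    have "{b*k..<b*k+k} \<inter> {c*k..<c*k+k} = {}" if "b \<noteq> c" for b c
      using less[of b c] less[of c b] that by (cases "b < c") auto
    then have blocks: "Suc ` {b*k..<b*k+k} \<inter> Suc ` {c*k..<c*k+k} = {}" if "b \<noteq> c" for b c
      using that by (metis image_Int image_empty inj_Suc)
    show "K i \<inter> K j = {}"
      using \<open>i \<noteq> j\<close> blocks unfolding K_def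
      by (cases i; cases j) (auto simp del: image_Suc_atLeastLessThan)
  qed
  have ind: "indep_vars (\<lambda>j. PiM (K j) (\<lambda>_. borel)) Y {..m}"
    unfolding Y_def by (rule indep_vars_restrict[OF indep _ disj]) simp
  have A_sets: "A j \<in> sets (PiM (K j) (\<lambda>_. borel))" for j
  proof (cases j)
    case 0
    have "(\<lambda>y. y 0) \<in> borel_measurable (PiM (K 0) (\<lambda>_. borel :: real measure))"
      by (rule measurable_component_singleton) (simp add: K_def)
    then show ?thesis unfolding 0 A_def nat.case by measurable
  next
    case (Suc b)
    have [measurable]:
      "(\<lambda>y. y (Suc i)) \<in> borel_measurable (PiM (K (Suc b)) (\<lambda>_. borel :: real measure))"
      if "i \<in> {b*k..<b*k+k}" for i
      by (rule measurable_component_singleton) (use that in \<open>simp add: K_def\<close>)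
    show ?thesis unfolding Suc A_def nat.case good_block_def by measurable
  qed
  have Y0: "Y 0 -` A 0 \<inter> space M = {\<omega> \<in> space M. t < T \<omega>}"
    by (auto simp: Y_def A_def K_def space_PiM)
  have YSuc: "Y (Suc b) -` A (Suc b) \<inter> space M = {\<omega> \<in> space M. good_block k a t (\<lambda>i. U i \<omega>) b}"
    for b
    by (auto simp: Y_def A_def K_def space_PiM good_block_def simp del: image_Suc_atLeastLessThan)
  have "prob (\<Inter>j\<in>{..m}. Y j -` A j \<inter> space M) = (\<Prod>j\<in>{..m}. prob (Y j -` A j \<inter> space M))"
    by (rule indep_varsD[OF ind]) (use A_sets in auto)
  also have "\<dots> = prob (Y 0 -` A 0 \<inter> space M) * (\<Prod>b<m. prob (Y (Suc b) -` A (Suc b) \<inter> space M))"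
    by (rule prod.atMost_shift)
  also have "(\<Inter>j\<in>{..m}. Y j -` A j \<inter> space M) =
      (Y 0 -` A 0 \<inter> space M) \<inter> (\<Inter>b<m. Y (Suc b) -` A (Suc b) \<inter> space M)"
  proof -
    have "{..m} = insert 0 (Suc ` {..<m})"
      by (metis lessThan_Suc_atMost lessThan_Suc_eq_insert_0)
    then show ?thesis by auto
  qed
  also have "\<dots> = {\<omega> \<in> space M. t < T \<omega> \<and> (\<forall>b<m. good_block k a t (\<lambda>i. U i \<omega>) b)}"
    unfolding Y0 YSuc by auto
  finally show ?thesis
    unfolding Y0 YSuc by (simp add: prob_good_block[OF assms])
qed

section \<open>Choice of the parameters\<close>

lemma prob_U_le_zero: "prob {\<omega> \<in> space M. U 0 \<omega> \<le> 0} = 0"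
proof -
  have "emeasure M (U 0 -` {0} \<inter> space M) =
      (\<integral>\<^sup>+x. ennreal (g x) * indicator {0..} x * indicator {0} x \<partial>lborel)"
    by (rule distributed_emeasure[OF U_density]) simp
  also have "\<dots> = (\<integral>\<^sup>+x. 0 \<partial>(lborel :: real measure))"
    by (rule nn_integral_cong_AE, use AE_lborel_singleton[of "0::real"] in eventually_elim) auto
  finally have "prob (U 0 -` {0} \<inter> space M) = 0"
    by (simp add: measure_def)
  moreover have "U 0 -` {0} \<inter> space M = {\<omega> \<in> space M. U 0 \<omega> \<le> 0}"
    using U_nonneg[of _ 0] by (auto intro: antisym)
  ultimately show ?thesis by simp
qed

lemma ex_prob_U_le_less_one: "\<exists>a>0. prob {\<omega> \<in> space M. U 0 \<omega> \<le> a} < 1"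
proof (rule ccontr)
  assume "\<not> ?thesis"
  then have one: "prob {\<omega> \<in> space M. U 0 \<omega> \<le> a} = 1" if "0 < a" for a
    using that by (meson antisym not_le prob_le_1)
  have "AE \<omega> in M. U 0 \<omega> \<le> inverse (real (Suc n))" for n
    using AE_prob_1[OF one[of "inverse (real (Suc n))"]] by simp
  then have "AE \<omega> in M. \<forall>n. U 0 \<omega> \<le> inverse (real (Suc n))"
    by (simp only: AE_all_countable) simp
  then have "AE \<omega> in M. U 0 \<omega> \<le> 0"
  proof eventually_elim
    case (elim \<omega>)
    then show ?case using reals_Archimedean[of "U 0 \<omega>"] by (meson not_le)
  qed
  then have "prob {\<omega> \<in> space M. U 0 \<omega> \<le> 0} = 1" by (subst prob_Collect_eq_1) auto
  then show False using prob_U_le_zero by simp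
qed

lemma prob_U_le_tendsto_one: "((\<lambda>t. prob {\<omega> \<in> space M. U 0 \<omega> \<le> t}) \<longlongrightarrow> 1) at_top"
proof -
  interpret D: real_distribution "distr M borel (U 0)"
    by (rule real_distribution_distr) simp
  have "cdf (distr M borel (U 0)) = (\<lambda>t. prob {\<omega> \<in> space M. U 0 \<omega> \<le> t})"
    by (auto simp: cdf_def measure_distr fun_eq_iff intro!: arg_cong[where f=prob])
  then show ?thesis using D.cdf_lim_at_top_prob by simp
qed

text \<open>
  The order of the choices matters: \<open>k\<close> makes \<open>P(U \<le> a) ^ k\<close> smaller than \<open>1 - q\<close> and does not
  depend on \<open>t\<close>, so that \<open>P(U \<le> t) ^ k\<close> tends to \<open>1\<close> as \<open>t\<close> grows with \<open>a\<close> and \<open>k\<close> fixed.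
\<close>

lemma ex_good_block_prob_gt:
  assumes "prob {\<omega> \<in> space M. U 0 \<omega> \<le> a} < 1" and "q < 1"
  obtains k t where "0 < k" and "a \<le> t" and "0 \<le> t"
    and "q < prob {\<omega> \<in> space M. U 0 \<omega> \<le> t} ^ k - prob {\<omega> \<in> space M. U 0 \<omega> \<le> a} ^ k"
proof -
  let ?F = "\<lambda>t. prob {\<omega> \<in> space M. U 0 \<omega> \<le> t}"
  have "(\<lambda>k. ?F a ^ k) \<longlonglongrightarrow> 0"
    using assms(1) by (intro LIMSEQ_realpow_zero) auto
  then have "\<forall>\<^sub>F k in sequentially. ?F a ^ k < 1 - q \<and> 0 < k"
    using \<open>q < 1\<close> by (intro eventually_conj order_tendstoD eventually_gt_at_top) auto
  then obtain k where k: "?F a ^ k < 1 - q" "0 < k"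
    by (auto simp: eventually_sequentially)
  have "((\<lambda>t. ?F t ^ k - ?F a ^ k) \<longlongrightarrow> 1 ^ k - ?F a ^ k) at_top"
    by (intro tendsto_intros prob_U_le_tendsto_one)
  then have "\<forall>\<^sub>F t in at_top. q < ?F t ^ k - ?F a ^ k"
    using k by (intro order_tendstoD) auto
  then have "\<forall>\<^sub>F t in at_top. q < ?F t ^ k - ?F a ^ k \<and> max a 0 \<le> t"
    by (intro eventually_conj eventually_ge_at_top)
  then obtain t where "q < ?F t ^ k - ?F a ^ k" "max a 0 \<le> t"
    using eventually_happens[of _ at_top] trivial_limit_at_top_linorder by blast
  with k show thesis by (intro that[of k t]) auto
qed

lemma prob_T_gt_pos:
  assumes "\<not> bounded (measure_support (distr M borel T))" and "0 \<le> t"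
  shows "0 < prob {\<omega> \<in> space M. t < T \<omega>}"
proof -
  obtain z where z: "z \<in> measure_support (distr M borel T)" and "t < \<bar>z\<bar>"
    using assms(1) unfolding bounded_iff real_norm_def by (meson not_le)
  \<comment> \<open>A support point below \<open>- t\<close> is impossible because \<open>T\<close> is nonnegative.\<close>
  have "\<not> z < 0"
  proof
    assume "z < 0"
    then have "0 < emeasure (distr M borel T) {..<0}"
      using z by (auto simp: measure_support_def)
    also have "emeasure (distr M borel T) {..<0} = emeasure M {}"
      by (subst emeasure_distr) (use T_nonneg in \<open>force intro!: arg_cong[where f="emeasure M"]\<close>)+
    finally show False by simp
  qed
  then have "0 < emeasure (distr M borel T) {t<..}"
    using z \<open>t < \<bar>z\<bar>\<close> by (auto simp: measure_support_def)
  also have "emeasure (distr M borel T) {t<..} = emeasure M {\<omega> \<in> space M. t < T \<omega>}"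
    by (subst emeasure_distr) (auto intro!: arg_cong[where f="emeasure M"])
  finally show ?thesis by (simp add: emeasure_eq_measure)
qed

section \<open>The exponential lower bound\<close>

lemma restart_tail_ge_exp:
  assumes "\<not> bounded (measure_support (distr M borel T))" and "0 < \<delta>"
  obtains C where "0 < C" and "\<And>x. 0 \<le> x \<Longrightarrow> C * exp (- \<delta> * x) \<le> restart_tail M T U x"
proof -
  obtain a where a: "0 < a" "prob {\<omega> \<in> space M. U 0 \<omega> \<le> a} < 1"
    using ex_prob_U_le_less_one by blast
  have "exp (- \<delta> * a) < 1" using a \<open>0 < \<delta>\<close> by simp
  with a(2) obtain k t where kt: "0 < k" "a \<le> t" "0 \<le> t" and \<beta>:
    "exp (- \<delta> * a) < prob {\<omega> \<in> space M. U 0 \<omega> \<le> t} ^ k - prob {\<omega> \<in> space M. U 0 \<omega> \<le> a} ^ k"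
    by (rule ex_good_block_prob_gt)
  let ?p = "prob {\<omega> \<in> space M. t < T \<omega>}"
  have p: "0 < ?p" using prob_T_gt_pos[OF assms(1) \<open>0 \<le> t\<close>] .
  \<comment> \<open>The factor \<open>exp (- \<delta> * a)\<close> pays for rounding \<open>x / a\<close> up to an integer number of blocks.\<close>
  show thesis
  proof (rule that)
    show "0 < ?p * exp (- \<delta> * a)" using p by simp
    fix x :: real assume "0 \<le> x"
    define m where "m = nat \<lceil>x / a\<rceil>"
    have "0 \<le> x / a" using \<open>0 \<le> x\<close> a by simp
    then have m: "x / a \<le> real m" "real m \<le> x / a + 1" unfolding m_def by linarith+
    have x: "x \<le> real m * a" "real m * a \<le> x + a" using m a by (auto simp: field_simps)
    have "exp (- \<delta> * a) * exp (- \<delta> * x) = exp (- \<delta> * (x + a))"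
      by (simp add: exp_add[symmetric] algebra_simps)
    also have "\<dots> \<le> exp (- \<delta> * (real m * a))" using x \<open>0 < \<delta>\<close> by simp
    also have "\<dots> = exp (- \<delta> * a) ^ m" by (simp add: exp_of_nat_mult[symmetric] algebra_simps)
    also have "\<dots> \<le> (prob {\<omega> \<in> space M. U 0 \<omega> \<le> t} ^ k - prob {\<omega> \<in> space M. U 0 \<omega> \<le> a} ^ k) ^ m"
      using \<beta> by (intro power_mono) auto
    finally have "?p * exp (- \<delta> * a) * exp (- \<delta> * x) \<le>
        prob {\<omega> \<in> space M. t < T \<omega> \<and> (\<forall>b<m. good_block k a t (\<lambda>i. U i \<omega>) b)}"
      unfolding prob_good_blocks[OF kt(1,2)] mult.assoc by (rule mult_left_mono) simp
    also have "\<dots> \<le> restart_tail M T U x"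
      unfolding restart_tail_def
    proof (rule finite_measure_mono)
      show "{\<omega> \<in> space M. t < T \<omega> \<and> (\<forall>b<m. good_block k a t (\<lambda>i. U i \<omega>) b)} \<subseteq>
          {\<omega> \<in> space M. restart_X T U \<omega> > ereal x}"
        using \<open>0 \<le> t\<close> x(1) U_nonneg
        by (auto intro!: restart_X_gt_of_good_blocks[where k=k and a=a and t=t and m=m])
    qed simp
    finally show "?p * exp (- \<delta> * a) * exp (- \<delta> * x) \<le> restart_tail M T U x" .
  qed
qed

end

theorem proposition1p2:
  fixes M :: "'a measure" and T :: "'a \<Rightarrow> real" and U :: "nat \<Rightarrow> 'a \<Rightarrow> real"
    and f g :: "real \<Rightarrow> real" and \<epsilon> :: real
  assumes "restart_model M T U f g"
    and "\<not> bounded (measure_support (distr M borel T))"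
    and "\<epsilon> > 0"
  shows "filterlim (\<lambda>x::real. exp (\<epsilon> * x) * restart_tail M T U x) at_top at_top"
proof -
  interpret restart_model M T U f g by fact
  have "0 < \<epsilon> / 2" using \<open>\<epsilon> > 0\<close> by simp
  with assms(2) obtain C where C: "0 < C"
      "\<And>x. 0 \<le> x \<Longrightarrow> C * exp (- (\<epsilon> / 2) * x) \<le> restart_tail M T U x"
    by (rule restart_tail_ge_exp) blast
  have "filterlim (\<lambda>x. exp (x * (\<epsilon> / 2))) at_top at_top"
    by (intro filterlim_compose[OF exp_at_top]
        filterlim_at_top_mult_tendsto_pos[OF tendsto_const _ filterlim_ident] \<open>0 < \<epsilon> / 2\<close>)
  then have "filterlim (\<lambda>x. C * exp (x * (\<epsilon> / 2))) at_top at_top"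
    by (rule filterlim_tendsto_pos_mult_at_top[OF tendsto_const \<open>0 < C\<close>])
  moreover have "\<forall>\<^sub>F x in at_top. C * exp (x * (\<epsilon> / 2)) \<le> exp (\<epsilon> * x) * restart_tail M T U x"
    using eventually_ge_at_top[of "0::real"]
  proof eventually_elim
    case (elim x)
    have "C * exp (x * (\<epsilon> / 2)) = exp (\<epsilon> * x) * (C * exp (- (\<epsilon> / 2) * x))"
      by (simp add: exp_add[symmetric] field_simps)
    also have "\<dots> \<le> exp (\<epsilon> * x) * restart_tail M T U x"
      using C(2)[OF elim] by (rule mult_left_mono) simp
    finally show ?case .
  qed
  ultimately show ?thesis by (rule filterlim_at_top_mono)
qed

end
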